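(* (Quantile MDP as a special case.) Let $t\in\mathbb{R}$ be fixed and let $V_N(x,s)=1$ if $s+g(x)\ge t$ and $V_N(x,s)=0$ otherwise. For $n=0,1,\ldots,N-1$ let $V_n$ be computed from the backward recursion $$V_n(x,s)=\sup_{a}\sum_{x'}V_{n+1}(x',s+r(x,a))\,q(x'|x,a).$$ Let $H:P(E\times S)\to\mathbb{R}$ be given by $H(F)=\sum_{x,s}F(x,s)V_N(x,s)$ (so that, applied to the joint distribution of $(X_N,R_{N-1})$ under a policy $\sigma$ and initial distribution $\nu$, $H$ gives the probability $\mathbb{P}_\nu^\sigma(R_N\ge t)$). For $F\in P(E\times S)$ define $J_N(F):=H(F)$ and $J_n(F):=\sup_{\pi\in\Pi^M}J_{n+1}(T^\pi(F))$, $n=0,1,\ldots,N-1$. Then for all $n=0,1,\ldots,N$ and $F\in P(E\times S)$, $$J_n(F)=\sum_{x,s}F(x,s)\,V_n(x,s).$$ Thus, the optimal strategy does not depend on $F$ and is deterministic.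
   Context: MDP data: $E$ is a finite state space, $A$ a finite action space, $r:E\times A\to\mathbb{R}$ the one-stage reward, $q$ the transition probability from $E\times A$ to $E$, $g:E\to\mathbb{R}$ the terminal reward, $N\in\mathbb{N}$ the time horizon. $P(Y)$ is the set of all probability distributions on $Y$. With $X_k$, $A_k$ the state and action at time $k$, the accumulated rewards are $R_n=\sum_{k=0}^n r(X_k,A_k)$ for $n=0,\ldots,N-1$ and $R_N=\sum_{k=0}^{N-1}r(X_k,A_k)+g(X_N)$. $S$ is the finite set of all possible realizations of $R_0,R_1,\ldots,R_N$. $\mathbb{P}_\nu^\sigma$ denotes the law of the state-action process under a history-dependent (possibly randomized) policy $\sigma$ with initial distribution $\nu$ on $E$. Lifted MDP (deterministic control problem): the state space is $P(E\times S)$, where a state $F_n$ at time $n$ is interpreted as the joint distribution of $(X_n,R_{n-1})$; the action space is $\Pi^M=\{\pi:E\times S\to P(A)\}$, written $\pi(a|x,s)$; the one-stage reward is zero and the terminal reward is $H$; the transition function $T:P(E\times S)\times\Pi^M\to P(E\times S)$ is $$T^\pi(F)(x',s')=T(F,\pi)(x',s')=\sum_{(x,s,a):\ r(x,a)=s'-s}q(x'|x,a)\,\pi(a|x,s)\,F(x,s),\qquad (x',s')\in E\times S.$$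
   Formalization: Since a finite S is in general not closed under s ↦ s+r(x,a), T need not map P(E×S) to itself; here T, the decision rules π and the V_n are taken on E×ℝ, F ranges over distributions supported in E×S, and S is any finite set containing R_{-1}=0 and all realizations. *)

theory Defs
  imports "HOL-Probability.Probability"
begin

text \<open>
  The finite state space \<open>E\<close> and the finite action space \<open>A\<close> are types of class \<open>finite\<close>, and
  \<open>q x a\<close> is the distribution \<open>q(\<cdot>|x,a)\<close> of the next state.

  A list \<open>h = [(x\<^sub>0,a\<^sub>0), \<dots>, (x\<^sub>k,a\<^sub>k)]\<close> is a history of states and actions, with
  accumulated reward \<open>R\<^sub>k\<close>; the empty history gives \<open>R\<close> at time \<open>-1\<close>, which is \<open>0\<close>.
\<close>

definition path_reward :: "('e \<Rightarrow> 'a \<Rightarrow> real) \<Rightarrow> ('e \<times> 'a) list \<Rightarrow> real" where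
  "path_reward r h = (\<Sum>(x, a)\<leftarrow>h. r x a)"

text \<open>
  The value \<open>0\<close> of the empty history is included, since a lifted state at time \<open>0\<close> is the joint
  distribution of \<open>X\<^sub>0\<close> and the reward accumulated before time \<open>0\<close>.
\<close>

definition reward_realizations ::
  "('e \<Rightarrow> 'a \<Rightarrow> real) \<Rightarrow> ('e \<Rightarrow> real) \<Rightarrow> nat \<Rightarrow> real set" where
  "reward_realizations r g N =
     {path_reward r h | h. length h \<le> N} \<union> {path_reward r h + g x | h x. length h = N}"

lemma finite_reward_realizations:
  fixes r :: "'e::finite \<Rightarrow> 'a::finite \<Rightarrow> real"
  shows "finite (reward_realizations r g N)"
proof -
  have fin: "finite {h :: ('e \<times> 'a) list. length h \<le> N}"
    using finite_lists_length_le[of "UNIV :: ('e \<times> 'a) set" N] by simp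
  have "reward_realizations r g N \<subseteq>
      path_reward r ` {h. length h \<le> N} \<union>
      (\<lambda>(h, x). path_reward r h + g x) ` ({h. length h \<le> N} \<times> UNIV)"
    unfolding reward_realizations_def by force
  then show ?thesis
    by (rule finite_subset) (intro finite_UnI finite_imageI finite_cartesian_product fin finite)
qed

text \<open>
  Joint law of the history before time \<open>n\<close> and the state \<open>X\<^sub>n\<close> under the history-dependent
  randomized policy \<open>\<sigma>\<close> and the initial distribution \<open>\<nu>\<close>.
\<close>

primrec process_law ::
  "('e \<Rightarrow> 'a \<Rightarrow> 'e pmf) \<Rightarrow> 'e pmf \<Rightarrow> (('e \<times> 'a) list \<Rightarrow> 'e \<Rightarrow> 'a pmf) \<Rightarrow> nat
     \<Rightarrow> (('e \<times> 'a) list \<times> 'e) pmf" where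
  "process_law q \<nu> \<sigma> 0 = map_pmf (\<lambda>x. ([], x)) \<nu>"
| "process_law q \<nu> \<sigma> (Suc n) =
     do {
       (h, x) \<leftarrow> process_law q \<nu> \<sigma> n;
       a \<leftarrow> \<sigma> h x;
       x' \<leftarrow> q x a;
       return_pmf (h @ [(x, a)], x')
     }"

text \<open>
  The set \<open>P(E \<times> S)\<close>. A finite set \<open>S\<close> of rewards is in general not closed under \<open>s \<mapsto> s + r x a\<close>,
  so the formula for \<open>T\<close> read on \<open>P(E \<times> S)\<close> would lose mass. The elements of \<open>P(E \<times> S)\<close>
  are therefore distributions on \<open>E \<times> \<real>\<close> supported in \<open>E \<times> S\<close>, and \<open>T\<close>, decision rules
  and value functions are defined for all rewards \<open>s \<in> \<real>\<close>.
\<close>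

definition dists_on :: "real set \<Rightarrow> ('e \<times> real) pmf set" where
  "dists_on S = {F. set_pmf F \<subseteq> UNIV \<times> S}"

definition lift_step ::
  "('e \<Rightarrow> 'a \<Rightarrow> real) \<Rightarrow> ('e \<Rightarrow> 'a \<Rightarrow> 'e pmf) \<Rightarrow> ('e \<times> real \<Rightarrow> 'a pmf)
     \<Rightarrow> ('e \<times> real) pmf \<Rightarrow> ('e \<times> real) pmf" where
  "lift_step r q \<pi> F =
     do {
       (x, s) \<leftarrow> F;
       a \<leftarrow> \<pi> (x, s);
       x' \<leftarrow> q x a;
       return_pmf (x', s + r x a)
     }"

lemma pmf_lift_step:
  fixes r :: "'e::finite \<Rightarrow> 'a::finite \<Rightarrow> real"
  assumes S: "finite S" and F: "F \<in> dists_on S"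
  shows "pmf (lift_step r q \<pi> F) (x', s') =
    (\<Sum>(x, s, a) | s \<in> S \<and> r x a = s' - s.
       pmf (q x a) x' * pmf (\<pi> (x, s)) a * pmf F (x, s))"
proof -
  have sub: "set_pmf F \<subseteq> UNIV \<times> S" using F by (simp add: dists_on_def)
  have fin: "finite ((UNIV :: 'e set) \<times> S)" using S by simp
  have inner: "pmf (q x a \<bind> (\<lambda>y. return_pmf (y, s + r x a))) (x', s') =
      (if r x a = s' - s then pmf (q x a) x' else 0)" for x a s
  proof -
    have "pmf (q x a \<bind> (\<lambda>y. return_pmf (y, s + r x a))) (x', s') =
        (\<Sum>y\<in>UNIV. pmf (return_pmf (y, s + r x a)) (x', s') * pmf (q x a) y)"
      by (simp add: pmf_bind integral_measure_pmf_real[where A = UNIV])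
    also have "\<dots> = (\<Sum>y\<in>UNIV. if y = x' then
        (if r x a = s' - s then pmf (q x a) y else 0) else 0)"
      by (intro sum.cong) (auto simp: indicator_def)
    finally show ?thesis by simp
  qed
  have "pmf (lift_step r q \<pi> F) (x', s') =
      (\<Sum>z\<in>UNIV \<times> S. (case z of (x, s) \<Rightarrow> \<Sum>a\<in>UNIV.
         (if r x a = s' - s then pmf (q x a) x' else 0) * pmf (\<pi> (x, s)) a) * pmf F z)"
    unfolding lift_step_def pmf_bind[of F]
    apply (subst integral_measure_pmf_real[OF fin])
    subgoal using sub by blast
    apply (intro sum.cong refl)
    by (auto simp: pmf_bind[of "\<pi> _"] integral_measure_pmf_real[where A = UNIV] inner)
  also have "\<dots> = (\<Sum>z\<in>UNIV \<times> S. \<Sum>a\<in>UNIV. case z of (x, s) \<Rightarrow>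
      if r x a = s' - s then pmf (q x a) x' * pmf (\<pi> (x, s)) a * pmf F (x, s) else 0)"
    by (intro sum.cong refl) (auto simp: sum_distrib_right intro!: sum.cong)
  also have "\<dots> = (\<Sum>((x, s), a)\<in>(UNIV \<times> S) \<times> UNIV.
      if r x a = s' - s then pmf (q x a) x' * pmf (\<pi> (x, s)) a * pmf F (x, s) else 0)"
    by (subst sum.cartesian_product) (auto intro!: sum.cong)
  also have "\<dots> = (\<Sum>(x, s, a)\<in>UNIV \<times> S \<times> UNIV.
      if r x a = s' - s then pmf (q x a) x' * pmf (\<pi> (x, s)) a * pmf F (x, s) else 0)"
    by (rule sum.reindex_bij_witness[of _ "\<lambda>(x, s, a). ((x, s), a)" "\<lambda>((x, s), a). (x, s, a)"]) auto
  also have "\<dots> = (\<Sum>(x, s, a) | s \<in> S \<and> r x a = s' - s.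
      pmf (q x a) x' * pmf (\<pi> (x, s)) a * pmf F (x, s))"
    by (rule sum.mono_neutral_cong_right) (use S in \<open>auto split: if_splits\<close>)
  finally show ?thesis .
qed

definition V_terminal :: "('e \<Rightarrow> real) \<Rightarrow> real \<Rightarrow> 'e \<Rightarrow> real \<Rightarrow> real" where
  "V_terminal g t x s = (if s + g x \<ge> t then 1 else 0)"

function V ::
  "('e::finite \<Rightarrow> 'a \<Rightarrow> real) \<Rightarrow> ('e \<Rightarrow> 'a \<Rightarrow> 'e pmf) \<Rightarrow> ('e \<Rightarrow> real) \<Rightarrow> real \<Rightarrow> nat
     \<Rightarrow> nat \<Rightarrow> 'e \<Rightarrow> real \<Rightarrow> real" where
  "V r q g t N n x s =
     (if n < N then SUP a. \<Sum>x'\<in>UNIV. V r q g t N (Suc n) x' (s + r x a) * pmf (q x a) x'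
      else V_terminal g t x s)"
  by auto
termination by (relation "Wellfounded.measure (\<lambda>(r, q, g, t, N, n, x, s). N - n)") auto

declare V.simps [simp del]

definition H :: "('e \<Rightarrow> real) \<Rightarrow> real \<Rightarrow> ('e \<times> real) pmf \<Rightarrow> real" where
  "H g t F = (\<Sum>(x, s)\<in>set_pmf F. pmf F (x, s) * V_terminal g t x s)"

function J ::
  "('e \<Rightarrow> 'a \<Rightarrow> real) \<Rightarrow> ('e \<Rightarrow> 'a \<Rightarrow> 'e pmf) \<Rightarrow> ('e \<Rightarrow> real) \<Rightarrow> real \<Rightarrow> nat
     \<Rightarrow> nat \<Rightarrow> ('e \<times> real) pmf \<Rightarrow> real" where
  "J r q g t N n F =
     (if n < N then SUP \<pi>. J r q g t N (Suc n) (lift_step r q \<pi> F) else H g t F)"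
  by auto
termination by (relation "Wellfounded.measure (\<lambda>(r, q, g, t, N, n, F). N - n)") auto

declare J.simps [simp del]

text \<open>
  Value in the lifted problem of the strategy \<open>(\<pi>\<^sub>n, \<dots>, \<pi>\<^sub>N\<^sub>-\<^sub>1)\<close> started at time \<open>n\<close> in \<open>F\<close>.
\<close>

definition strategy_value ::
  "('e \<Rightarrow> 'a \<Rightarrow> real) \<Rightarrow> ('e \<Rightarrow> 'a \<Rightarrow> 'e pmf) \<Rightarrow> ('e \<Rightarrow> real) \<Rightarrow> real \<Rightarrow> nat
     \<Rightarrow> (nat \<Rightarrow> 'e \<times> real \<Rightarrow> 'a pmf) \<Rightarrow> nat \<Rightarrow> ('e \<times> real) pmf \<Rightarrow> real" where
  "strategy_value r q g t N \<pi> n F = H g t (fold (\<lambda>k. lift_step r q (\<pi> k)) [n..<N] F)"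

end

theory Submission
  imports Defs
begin

text \<open>
  In the lifted problem the state \<open>F\<close> is a distribution, the transition \<open>lift_step\<close> is affine in
  \<open>F\<close>, and the terminal reward \<open>H\<close> is linear in \<open>F\<close>, being the expectation of \<open>V_terminal\<close>.
  Hence an expectation after one transition is again an expectation under \<open>F\<close>: averaging \<open>V\<close> at
  time \<open>n + 1\<close> over \<open>lift_step r q \<pi> F\<close> is averaging, over \<open>F\<close>, the \<open>\<pi> (x, s)\<close>-mean of the
  one-step action values (\<open>expectation_V_lift_step\<close>).  This mean never exceeds the largest action
  value, which is \<open>V\<close> at time \<open>n\<close>, and it equals it when \<open>\<pi>\<close> puts all its mass on a maximizing
  action.  So the supremum over decision rules may be taken separately inside the expectation, at
  each pair \<open>(x, s)\<close>, and a maximizing rule can be chosen once and for all, without knowing \<open>F\<close>.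
  Backward induction turns this single step into the formula for \<open>J\<close> (\<open>J_eq_expectation\<close>), into
  the bound on the value of every strategy (\<open>strategy_value_le\<close>) and into its attainment by the
  greedy deterministic strategy (\<open>strategy_value_greedy\<close>).

  All of this holds for every finitely supported \<open>F\<close>.  Working with this class instead of
  \<open>dists_on S\<close> matters for the induction: \<open>lift_step\<close> preserves finite support, whereas it can
  lead out of \<open>dists_on S\<close>.
\<close>

section \<open>Expectations under lifted states\<close>

lemma expectation_eq_sum_dists_on:
  fixes F :: "('e::finite \<times> real) pmf"
  assumes "finite S" and "F \<in> dists_on S"
  shows "measure_pmf.expectation F (\<lambda>(x, s). v x s) = (\<Sum>x\<in>UNIV. \<Sum>s\<in>S. pmf F (x, s) * v x s)"
proof -
  have "measure_pmf.expectation F (\<lambda>(x, s). v x s) =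
      (\<Sum>z\<in>UNIV \<times> S. (case z of (x, s) \<Rightarrow> v x s) * pmf F z)"
    by (rule integral_measure_pmf_real) (use assms in \<open>auto simp: dists_on_def\<close>)
  also have "\<dots> = (\<Sum>x\<in>UNIV. \<Sum>s\<in>S. pmf F (x, s) * v x s)"
    by (simp add: sum.cartesian_product case_prod_beta mult.commute)
  finally show ?thesis .
qed

lemma finite_set_pmf_dists_on:
  fixes F :: "('e::finite \<times> real) pmf"
  assumes "finite S" and "F \<in> dists_on S"
  shows "finite (set_pmf F)"
  by (rule finite_subset[of _ "UNIV \<times> S"]) (use assms in \<open>auto simp: dists_on_def\<close>)

lemma H_eq_expectation:
  assumes "finite (set_pmf F)"
  shows "H g t F = measure_pmf.expectation F (\<lambda>(x, s). V_terminal g t x s)"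
  unfolding H_def
  by (subst integral_measure_pmf_real[OF assms]) (auto intro!: sum.cong)

section \<open>The terminal reward as a probability\<close>

lemma finite_set_process_law:
  fixes q :: "'e::finite \<Rightarrow> 'a::finite \<Rightarrow> 'e pmf"
  shows "finite (set_pmf (process_law q \<nu> \<sigma> n))"
  by (induction n) auto

text \<open>
  \<open>V_terminal\<close> is the indicator of the event that the total reward, terminal reward included,
  reaches \<open>t\<close>, so its expectation is the probability of that event.
\<close>

lemma H_process_law:
  fixes q :: "'e::finite \<Rightarrow> 'a::finite \<Rightarrow> 'e pmf"
  shows "H g t (map_pmf (\<lambda>(h, x). (x, path_reward r h)) (process_law q \<nu> \<sigma> N)) =
    measure_pmf.prob (process_law q \<nu> \<sigma> N) {(h, x). path_reward r h + g x \<ge> t}"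
proof -
  have "H g t (map_pmf (\<lambda>(h, x). (x, path_reward r h)) (process_law q \<nu> \<sigma> N)) =
      measure_pmf.expectation (process_law q \<nu> \<sigma> N)
        (\<lambda>z. V_terminal g t (snd z) (path_reward r (fst z)))"
    by (subst H_eq_expectation) (auto simp: finite_set_process_law case_prod_beta)
  also have "\<dots> = measure_pmf.expectation (process_law q \<nu> \<sigma> N)
      (indicator {(h, x). path_reward r h + g x \<ge> t})"
    by (intro Bochner_Integration.integral_cong) (auto simp: V_terminal_def indicator_def)
  finally show ?thesis by simp
qed

section \<open>One step of the lifted problem\<close>

lemma finite_set_lift_step:
  fixes r :: "'e::finite \<Rightarrow> 'a::finite \<Rightarrow> real"
  assumes "finite (set_pmf F)"
  shows "finite (set_pmf (lift_step r q \<pi> F))"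
  using assms by (auto simp: lift_step_def)

lemma expectation_lift_step:
  fixes r :: "'e::finite \<Rightarrow> 'a::finite \<Rightarrow> real"
  assumes "finite (set_pmf F)"
  shows "measure_pmf.expectation (lift_step r q \<pi> F) v =
    measure_pmf.expectation F (\<lambda>(x, s). measure_pmf.expectation (\<pi> (x, s))
      (\<lambda>a. \<Sum>x'\<in>UNIV. v (x', s + r x a) * pmf (q x a) x'))"
proof -
  let ?K = "\<lambda>x s a. q x a \<bind> (\<lambda>x'. return_pmf (x', s + r x a))"
  have next_state: "measure_pmf.expectation (?K x s a) v =
      (\<Sum>x'\<in>UNIV. v (x', s + r x a) * pmf (q x a) x')" for x s a
    by (subst pmf_expectation_bind[of UNIV]) (auto simp: mult.commute)
  have action: "measure_pmf.expectation (\<pi> (x, s) \<bind> ?K x s) v =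
      measure_pmf.expectation (\<pi> (x, s))
        (\<lambda>a. \<Sum>x'\<in>UNIV. v (x', s + r x a) * pmf (q x a) x')" for x s
    by (subst pmf_expectation_bind[of UNIV])
      (auto simp: next_state integral_measure_pmf_real[where A = UNIV] mult.commute)
  show ?thesis
    unfolding lift_step_def
    by (subst pmf_expectation_bind[of "set_pmf F"], use assms in \<open>auto simp: case_prod_beta\<close>)
      (auto simp: action integral_measure_pmf_real[OF assms] case_prod_beta mult.commute
         intro!: sum.cong)
qed

definition action_value ::
  "('e::finite \<Rightarrow> 'a \<Rightarrow> real) \<Rightarrow> ('e \<Rightarrow> 'a \<Rightarrow> 'e pmf) \<Rightarrow> ('e \<Rightarrow> real) \<Rightarrow> real \<Rightarrow> nat
     \<Rightarrow> nat \<Rightarrow> 'e \<Rightarrow> real \<Rightarrow> 'a \<Rightarrow> real" where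
  "action_value r q g t N n x s a =
     (\<Sum>x'\<in>UNIV. V r q g t N (Suc n) x' (s + r x a) * pmf (q x a) x')"

lemma V_eq_SUP_action_value:
  "n < N \<Longrightarrow> V r q g t N n x s = (SUP a. action_value r q g t N n x s a)"
  by (simp add: V.simps[of r q g t N n] action_value_def)

lemma action_value_le_V:
  fixes r :: "'e::finite \<Rightarrow> 'a::finite \<Rightarrow> real"
  assumes "n < N"
  shows "action_value r q g t N n x s a \<le> V r q g t N n x s"
  unfolding V_eq_SUP_action_value[OF assms] by (rule cSUP_upper) auto

definition greedy_action ::
  "('e::finite \<Rightarrow> 'a \<Rightarrow> real) \<Rightarrow> ('e \<Rightarrow> 'a \<Rightarrow> 'e pmf) \<Rightarrow> ('e \<Rightarrow> real) \<Rightarrow> real \<Rightarrow> nat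
     \<Rightarrow> nat \<Rightarrow> 'e \<times> real \<Rightarrow> 'a" where
  "greedy_action r q g t N n = (\<lambda>(x, s). SOME a. action_value r q g t N n x s a = V r q g t N n x s)"

text \<open>The supremum over the finite action space is a maximum, so a greedy action exists.\<close>

lemma action_value_greedy:
  fixes r :: "'e::finite \<Rightarrow> 'a::finite \<Rightarrow> real"
  assumes "n < N"
  shows "action_value r q g t N n x s (greedy_action r q g t N n (x, s)) = V r q g t N n x s"
proof -
  let ?Q = "action_value r q g t N n x s"
  have "V r q g t N n x s = Max (range ?Q)"
    unfolding V_eq_SUP_action_value[OF assms] by (rule cSup_eq_Max) auto
  also have "\<dots> \<in> range ?Q" by (rule Max_in) auto
  finally have "\<exists>a. ?Q a = V r q g t N n x s" by auto
  then show ?thesis unfolding greedy_action_def prod.case by (rule someI_ex)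
qed

abbreviation expected_V ::
  "('e::finite \<Rightarrow> 'a \<Rightarrow> real) \<Rightarrow> ('e \<Rightarrow> 'a \<Rightarrow> 'e pmf) \<Rightarrow> ('e \<Rightarrow> real) \<Rightarrow> real \<Rightarrow> nat
     \<Rightarrow> nat \<Rightarrow> ('e \<times> real) pmf \<Rightarrow> real" where
  "expected_V r q g t N n F \<equiv> measure_pmf.expectation F (\<lambda>(x, s). V r q g t N n x s)"

lemma expectation_V_lift_step:
  fixes r :: "'e::finite \<Rightarrow> 'a::finite \<Rightarrow> real"
  assumes "finite (set_pmf F)"
  shows "expected_V r q g t N (Suc n) (lift_step r q \<pi> F) =
    measure_pmf.expectation F (\<lambda>(x, s).
      measure_pmf.expectation (\<pi> (x, s)) (action_value r q g t N n x s))"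
  using expectation_lift_step[OF assms, of r q \<pi> "\<lambda>(x, s). V r q g t N (Suc n) x s"]
  by (simp add: action_value_def[abs_def])

text \<open>
  A mean of action values is at most their maximum, whatever randomization \<open>\<pi>\<close> uses, and
  integrating this pointwise bound over \<open>F\<close> gives the bound for the whole distribution.
\<close>

lemma expected_V_lift_step_le:
  fixes r :: "'e::finite \<Rightarrow> 'a::finite \<Rightarrow> real"
  assumes "n < N" and "finite (set_pmf F)"
  shows "expected_V r q g t N (Suc n) (lift_step r q \<pi> F) \<le> expected_V r q g t N n F"
proof -
  have "measure_pmf.expectation p (action_value r q g t N n x s) \<le> V r q g t N n x s"
    for x s and p :: "'a pmf"
    by (rule measure_pmf.integral_le_const)
      (auto intro: integrable_measure_pmf_finite simp: action_value_le_V[OF assms(1)])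
  then show ?thesis
    unfolding expectation_V_lift_step[OF assms(2)]
    by (intro integral_mono integrable_measure_pmf_finite assms(2)) auto
qed

lemma expected_V_lift_step_greedy:
  fixes r :: "'e::finite \<Rightarrow> 'a::finite \<Rightarrow> real"
  assumes "n < N" and "finite (set_pmf F)"
  shows "expected_V r q g t N (Suc n)
      (lift_step r q (\<lambda>z. return_pmf (greedy_action r q g t N n z)) F) = expected_V r q g t N n F"
  unfolding expectation_V_lift_step[OF assms(2)]
  by (simp add: action_value_greedy[OF assms(1)])

section \<open>Backward induction\<close>

lemma expected_V_terminal:
  assumes "finite (set_pmf F)"
  shows "expected_V r q g t N N F = H g t F"
  by (simp add: H_eq_expectation[OF assms] V.simps)

text \<open>
  The supremum in the recursion for \<open>J\<close> is attained, by the greedy rule.  This also spares a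
  separate argument that the set of values is bounded above.
\<close>

lemma J_eq_expectation:
  fixes r :: "'e::finite \<Rightarrow> 'a::finite \<Rightarrow> real"
  assumes "n \<le> N" and "finite (set_pmf F)"
  shows "J r q g t N n F = expected_V r q g t N n F"
  using assms
proof (induction n arbitrary: F rule: inc_induct)
  case base
  then show ?case using expected_V_terminal[of F r q g t N] by (simp add: J.simps)
next
  case (step n)
  have "J r q g t N n F = (SUP \<pi>. expected_V r q g t N (Suc n) (lift_step r q \<pi> F))"
    using step by (simp add: J.simps[of r q g t N n] finite_set_lift_step)
  also have "\<dots> = expected_V r q g t N n F"
  proof (rule cSup_eq_maximum)
    show "expected_V r q g t N n F \<in>
        range (\<lambda>\<pi>. expected_V r q g t N (Suc n) (lift_step r q \<pi> F))"
      by (rule range_eqI) (rule expected_V_lift_step_greedy[OF step.hyps(2) step.prems, symmetric])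
  qed (use expected_V_lift_step_le[OF step.hyps(2) step.prems] in auto)
  finally show ?case .
qed

lemma strategy_value_end: "strategy_value r q g t N \<pi> N F = H g t F"
  by (simp add: strategy_value_def)

lemma strategy_value_step:
  "n < N \<Longrightarrow>
    strategy_value r q g t N \<pi> n F = strategy_value r q g t N \<pi> (Suc n) (lift_step r q (\<pi> n) F)"
  by (simp add: strategy_value_def upt_conv_Cons)

lemma strategy_value_le:
  fixes r :: "'e::finite \<Rightarrow> 'a::finite \<Rightarrow> real"
  assumes "n \<le> N" and "finite (set_pmf F)"
  shows "strategy_value r q g t N \<pi> n F \<le> expected_V r q g t N n F"
  using assms
proof (induction n arbitrary: F rule: inc_induct)
  case base
  then show ?case by (simp add: strategy_value_end expected_V_terminal)
next
  case (step n)
  have "strategy_value r q g t N \<pi> n F \<le> expected_V r q g t N (Suc n) (lift_step r q (\<pi> n) F)"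
    using step by (simp add: strategy_value_step finite_set_lift_step)
  also have "\<dots> \<le> expected_V r q g t N n F"
    by (rule expected_V_lift_step_le[OF step.hyps(2) step.prems])
  finally show ?case .
qed

lemma strategy_value_greedy:
  fixes r :: "'e::finite \<Rightarrow> 'a::finite \<Rightarrow> real"
  assumes "n \<le> N" and "finite (set_pmf F)"
  shows "strategy_value r q g t N (\<lambda>k z. return_pmf (greedy_action r q g t N k z)) n F =
    expected_V r q g t N n F"
  using assms
proof (induction n arbitrary: F rule: inc_induct)
  case base
  then show ?case by (simp add: strategy_value_end expected_V_terminal)
next
  case (step n)
  then show ?case
    by (simp add: strategy_value_step finite_set_lift_step expected_V_lift_step_greedy)
qed

theorem mainTheorem6:
  fixes r :: "'e::finite \<Rightarrow> 'a::finite \<Rightarrow> real"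
    and q :: "'e \<Rightarrow> 'a \<Rightarrow> 'e pmf"
    and g :: "'e \<Rightarrow> real"
    and t :: real
    and N :: nat
    and S :: "real set"
  assumes "finite S" and "reward_realizations r g N \<subseteq> S"
  shows
    "(\<forall>(\<nu> :: 'e pmf) \<sigma>.
        H g t (map_pmf (\<lambda>(h, x). (x, path_reward r h)) (process_law q \<nu> \<sigma> N)) =
        measure_pmf.prob (process_law q \<nu> \<sigma> N) {(h, x). path_reward r h + g x \<ge> t}) \<and>
     (\<forall>n\<le>N. \<forall>F\<in>dists_on S.
        J r q g t N n F = (\<Sum>x\<in>UNIV. \<Sum>s\<in>S. pmf F (x, s) * V r q g t N n x s)) \<and>
     (\<exists>f :: nat \<Rightarrow> 'e \<times> real \<Rightarrow> 'a. \<forall>n\<le>N. \<forall>F\<in>dists_on S.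
        strategy_value r q g t N (\<lambda>k z. return_pmf (f k z)) n F = J r q g t N n F \<and>
        (\<forall>\<pi>. strategy_value r q g t N \<pi> n F
               \<le> strategy_value r q g t N (\<lambda>k z. return_pmf (f k z)) n F))"
proof (intro conjI allI ballI impI exI[of _ "greedy_action r q g t N"])
  show "H g t (map_pmf (\<lambda>(h, x). (x, path_reward r h)) (process_law q \<nu> \<sigma> N)) =
      measure_pmf.prob (process_law q \<nu> \<sigma> N) {(h, x). path_reward r h + g x \<ge> t}"
    for \<nu> :: "'e pmf" and \<sigma>
    by (rule H_process_law)
next
  fix n and F :: "('e \<times> real) pmf"
  assume n: "n \<le> N" and F: "F \<in> dists_on S"
  note fin = finite_set_pmf_dists_on[OF assms(1) F]
  show "J r q g t N n F = (\<Sum>x\<in>UNIV. \<Sum>s\<in>S. pmf F (x, s) * V r q g t N n x s)"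
    unfolding J_eq_expectation[OF n fin] by (rule expectation_eq_sum_dists_on[OF assms(1) F])
  show "strategy_value r q g t N (\<lambda>k z. return_pmf (greedy_action r q g t N k z)) n F =
      J r q g t N n F"
    by (simp add: J_eq_expectation[OF n fin] strategy_value_greedy[OF n fin])
  show "strategy_value r q g t N \<pi> n F \<le>
      strategy_value r q g t N (\<lambda>k z. return_pmf (greedy_action r q g t N k z)) n F" for \<pi>
    unfolding strategy_value_greedy[OF n fin] by (rule strategy_value_le[OF n fin])
qed

end
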